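(* Let $s>2$, let $\mathcal{Q}$ be a generalised quadrangle of order $(s,s^2)$ and $\mathcal{Q}'$ a doubly subtended subquadrangle of order $(s,s)$, and let $(\Omega,\{R_0,\dots,R_4\})$ be the Penttila–Williford scheme defined in the context, with simultaneous eigenspaces $V_0,\dots,V_4$ in its $Q$-bipartite ordering. Let $\theta\subseteq\Omega$ be nontrivial ($\emptyset\ne\theta\ne\Omega$) and suppose that $\chi_\theta\in V_0\perp V_1$, or $\chi_\theta\in V_0\perp V_3$, or $\chi_\theta\in V_0\perp V_1\perp V_3$. Then $|\theta|=\tfrac12|\Omega|$.
   Context: A generalised quadrangle of order $(s,t)$ is a point–line geometry with $s+1$ points per line, $t+1$ lines per point, two points on at most one common line, such that for every non-incident point $P$ and line $\ell$ there is exactly one point on $\ell$ collinear with $P$. Let $\mathcal{Q}'$ be a subquadrangle of $\mathcal{Q}$ of order $(s,t')$. For a point $P$ of $\mathcal{Q}$ not in $\mathcal{Q}'$, the set $\mathcal{O}_P$ of points of $\mathcal{Q}'$ collinear with $P$ is an ovoid of $\mathcal{Q}'$ (subtended by $P$); it is doubly subtended if exactly one other point $P'\ne P$ has $\mathcal{O}_{P'}=\mathcal{O}_P$, and $\mathcal{Q}'$ is doubly subtended in $\mathcal{Q}$ if every subtended ovoid is doubly subtended. The Penttila–Williford scheme has vertex set $\Omega$ = points of $\mathcal{Q}$ not in $\mathcal{Q}'$ and relations: $R_0$ identity; $(X,Y)\in R_1$ iff $X,Y$ are not collinear and $|\mathcal{O}_X\cap\mathcal{O}_Y|=1$; $(X,Y)\in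 R_2$ iff $X,Y$ are not collinear and $|\mathcal{O}_X\cap\mathcal{O}_Y|=s+1$; $(X,Y)\in R_3$ iff $X\ne Y$ are collinear in $\mathcal{Q}$; $(X,Y)\in R_4$ iff $X\neq Y$ and $\mathcal{O}_X=\mathcal{O}_Y$. This is a 4-class association scheme which is $Q$-bipartite: its minimal idempotents $E_0=\frac1{|\Omega|}J,E_1,\dots,E_4$ can be ordered so that the Krein parameters (defined by $E_i\circ E_j=\frac1{|\Omega|}\sum_hq_{ij}^hE_h$) satisfy $q_{ij}^h=0$ whenever $i+j+h$ is odd; $V_i$ is the column space of $E_i$ in this ordering. $\chi_\theta$ is the characteristic vector of $\theta$. *)

theory Defs
  imports "HOL-Analysis.Analysis"
begin

text \<open>
  A point--line geometry is given by a set of points, a set of lines and an incidence relation.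
  A subgeometry uses the same incidence relation, restricted to its own points and lines.
\<close>

definition collin :: "'l set \<Rightarrow> ('p \<Rightarrow> 'l \<Rightarrow> bool) \<Rightarrow> 'p \<Rightarrow> 'p \<Rightarrow> bool" where
  "collin L I x y \<longleftrightarrow> (\<exists>l\<in>L. I x l \<and> I y l)"

definition generalised_quadrangle ::
    "'p set \<Rightarrow> 'l set \<Rightarrow> ('p \<Rightarrow> 'l \<Rightarrow> bool) \<Rightarrow> nat \<Rightarrow> nat \<Rightarrow> bool" where
  "generalised_quadrangle P L I s t \<longleftrightarrow>
     P \<noteq> {} \<and>
     (\<forall>l\<in>L. card {x \<in> P. I x l} = s + 1) \<and>
     (\<forall>x\<in>P. card {l \<in> L. I x l} = t + 1) \<and>
     (\<forall>x\<in>P. \<forall>y\<in>P. \<forall>l\<in>L. \<forall>m\<in>L. x \<noteq> y \<and> I x l \<and> I y l \<and> I x m \<and> I y m \<longrightarrow> l = m) \<and>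
     (\<forall>x\<in>P. \<forall>l\<in>L. \<not> I x l \<longrightarrow> (\<exists>!y. y \<in> P \<and> I y l \<and> collin L I x y))"

definition subquadrangle ::
    "'p set \<Rightarrow> 'l set \<Rightarrow> 'p set \<Rightarrow> 'l set \<Rightarrow> ('p \<Rightarrow> 'l \<Rightarrow> bool) \<Rightarrow> nat \<Rightarrow> nat \<Rightarrow> bool" where
  "subquadrangle P' L' P L I s t' \<longleftrightarrow>
     P' \<subseteq> P \<and> L' \<subseteq> L \<and> generalised_quadrangle P' L' I s t'"

definition subtended :: "'p set \<Rightarrow> 'l set \<Rightarrow> ('p \<Rightarrow> 'l \<Rightarrow> bool) \<Rightarrow> 'p \<Rightarrow> 'p set" where
  "subtended P' L I X = {Z \<in> P'. collin L I X Z}"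

definition doubly_subtended ::
    "'p set \<Rightarrow> 'p set \<Rightarrow> 'l set \<Rightarrow> ('p \<Rightarrow> 'l \<Rightarrow> bool) \<Rightarrow> bool" where
  "doubly_subtended P' P L I \<longleftrightarrow>
     (\<forall>X \<in> P - P'. \<exists>!Y. Y \<in> P - P' \<and> Y \<noteq> X \<and> subtended P' L I Y = subtended P' L I X)"

definition PW_rel ::
    "'p set \<Rightarrow> 'p set \<Rightarrow> 'l set \<Rightarrow> ('p \<Rightarrow> 'l \<Rightarrow> bool) \<Rightarrow> nat \<Rightarrow> nat \<Rightarrow> ('p \<times> 'p) set" where
  "PW_rel P' P L I s i =
     {(X, Y). X \<in> P - P' \<and> Y \<in> P - P' \<and>
       (i = 0 \<and> X = Y \<or>
        i = 1 \<and> \<not> collin L I X Y \<and> card (subtended P' L I X \<inter> subtended P' L I Y) = 1 \<or>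
        i = 2 \<and> \<not> collin L I X Y \<and> card (subtended P' L I X \<inter> subtended P' L I Y) = s + 1 \<or>
        i = 3 \<and> X \<noteq> Y \<and> collin L I X Y \<or>
        i = 4 \<and> X \<noteq> Y \<and> subtended P' L I X = subtended P' L I Y)}"

text \<open>
  The vertex set of a scheme is a subset \<open>\<Omega>\<close> of a finite type \<open>'p\<close>. Vectors and matrices indexed
  by \<open>\<Omega>\<close> are the elements of \<open>real ^ 'p\<close> and \<open>real ^ 'p ^ 'p\<close> that vanish outside \<open>\<Omega>\<close> and
  \<open>\<Omega> \<times> \<Omega>\<close>; sums, matrix products, entrywise products and column spaces agree under this
  embedding. The identity matrix on \<open>\<Omega>\<close> is the adjacency matrix of the identity relation on \<open>\<Omega>\<close>,
  not \<open>mat 1\<close>.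
\<close>

definition char_vec :: "'p::finite set \<Rightarrow> real ^ 'p" where
  "char_vec S = (\<chi> x. if x \<in> S then 1 else 0)"

definition adj_mat :: "('p \<times> 'p) set \<Rightarrow> real ^ 'p ^ 'p::finite" where
  "adj_mat R = (\<chi> x y. if (x, y) \<in> R then 1 else 0)"

definition schur_prod :: "real ^ 'p ^ 'p \<Rightarrow> real ^ 'p ^ 'p \<Rightarrow> real ^ 'p ^ 'p::finite" where
  "schur_prod A B = (\<chi> x y. A $ x $ y * B $ x $ y)"

definition bose_mesner :: "nat \<Rightarrow> (nat \<Rightarrow> ('p \<times> 'p) set) \<Rightarrow> (real ^ 'p ^ 'p::finite) set" where
  "bose_mesner d R = span ((\<lambda>i. adj_mat (R i)) ` {..d})"

definition minimal_idempotent :: "(real ^ 'p ^ 'p::finite) set \<Rightarrow> real ^ 'p ^ 'p \<Rightarrow> bool" where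
  "minimal_idempotent A e \<longleftrightarrow>
     e \<in> A \<and> e \<noteq> 0 \<and> e ** e = e \<and>
     (\<forall>f\<in>A. f ** f = f \<and> e ** f = f \<and> f ** e = f \<longrightarrow> f = 0 \<or> f = e)"

definition idempotent_ordering ::
    "'p::finite set \<Rightarrow> nat \<Rightarrow> (nat \<Rightarrow> ('p \<times> 'p) set) \<Rightarrow> (nat \<Rightarrow> real ^ 'p ^ 'p) \<Rightarrow> bool" where
  "idempotent_ordering \<Omega> d R E \<longleftrightarrow>
     bij_betw E {..d} {e. minimal_idempotent (bose_mesner d R) e} \<and>
     E 0 = (1 / real (card \<Omega>)) *\<^sub>R adj_mat (\<Omega> \<times> \<Omega>)"

definition krein_parameters ::
    "'p::finite set \<Rightarrow> nat \<Rightarrow> (nat \<Rightarrow> real ^ 'p ^ 'p) \<Rightarrow> (nat \<Rightarrow> nat \<Rightarrow> nat \<Rightarrow> real) \<Rightarrow> bool" where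
  "krein_parameters \<Omega> d E q \<longleftrightarrow>
     (\<forall>i\<le>d. \<forall>j\<le>d.
        schur_prod (E i) (E j) = (1 / real (card \<Omega>)) *\<^sub>R (\<Sum>h\<le>d. q i j h *\<^sub>R E h))"

definition Q_bipartite_ordering ::
    "'p::finite set \<Rightarrow> nat \<Rightarrow> (nat \<Rightarrow> ('p \<times> 'p) set) \<Rightarrow> (nat \<Rightarrow> real ^ 'p ^ 'p) \<Rightarrow> bool" where
  "Q_bipartite_ordering \<Omega> d R E \<longleftrightarrow>
     idempotent_ordering \<Omega> d R E \<and>
     (\<exists>q. krein_parameters \<Omega> d E q \<and>
        (\<forall>i\<le>d. \<forall>j\<le>d. \<forall>h\<le>d. odd (i + j + h) \<longrightarrow> q i j h = 0))"

definition col_space :: "real ^ 'p ^ 'p::finite \<Rightarrow> (real ^ 'p) set" where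
  "col_space A = span (columns A)"

text \<open>The sum underlying \<open>U \<bottom> W\<close>. It is only applied to column spaces of distinct minimal
  idempotents, which are automatically orthogonal.\<close>

definition orth_sum :: "(real ^ 'p::finite) set \<Rightarrow> (real ^ 'p) set \<Rightarrow> (real ^ 'p) set" where
  "orth_sum U W = {u + w | u w. u \<in> U \<and> w \<in> W}"

end

theory Submission
  imports Defs
begin

text \<open>
  Write \<open>\<chi>\<^sub>\<theta> = c 1 + v\<close> with \<open>v \<in> V\<^sub>1 + V\<^sub>3\<close>. Since \<open>\<chi>\<^sub>\<theta>\<close> is idempotent for the entrywise
  product \<open>\<circ>\<close>, we have \<open>v \<circ> v = (1 - 2c) \<chi>\<^sub>\<theta> + c\<^sup>2 1\<close>. The vanishing Krein parameters give
  \<open>E\<^sub>1 (v \<circ> v) = E\<^sub>3 (v \<circ> v) = 0\<close>, so \<open>(1 - 2c) v = 0\<close>; as \<open>\<theta>\<close> is nontrivial, \<open>v \<noteq> 0\<close> and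
  \<open>c = 1/2\<close>.

  This uses that the \<open>E\<^sub>i\<close> are symmetric and mutually orthogonal, which holds because the span
  of the adjacency matrices is closed under multiplication. In a quadrangle of order \<open>(s, s\<^sup>2)\<close> every triad
  has exactly \<open>s + 1\<close> centres. Hence, if \<open>T = A\<^sub>4\<close> is the involution interchanging the two points
  that subtend the same ovoid, then \<open>A\<^sub>1 = T A\<^sub>3 = A\<^sub>3 T\<close> and \<open>A\<^sub>2 = J - 1 - A\<^sub>1 - A\<^sub>3 - T\<close>, and it
  remains to expand \<open>A\<^sub>3\<^sup>2\<close>, whose entries count common neighbours outside the subquadrangle.
\<close>

section \<open>Counting in generalised quadrangles\<close>

lemma collin_sym: "collin L I x y \<longleftrightarrow> collin L I y x"
  by (auto simp: collin_def)

lemma card_eq_1_iff_ex1: "card {x. Q x} = 1 \<longleftrightarrow> (\<exists>!x. Q x)"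
  by (auto simp: card_1_singleton_iff set_eq_iff)

lemma card_off_diagonal:
  "finite C \<Longrightarrow> card {(u, v). u \<in> C \<and> v \<in> C \<and> u \<noteq> v} = card C * (card C - 1)"
proof -
  assume "finite C"
  have "{(u, v). u \<in> C \<and> v \<in> C \<and> u \<noteq> v} = Sigma C (\<lambda>u. C - {u})"
    by auto
  then show ?thesis
    using \<open>finite C\<close> by simp
qed

locale gen_quadrangle =
  fixes P :: "'p::finite set" and L :: "'l set" and I :: "'p \<Rightarrow> 'l \<Rightarrow> bool" and s t :: nat
  assumes gq: "generalised_quadrangle P L I s t"
begin

abbreviation col :: "'p \<Rightarrow> 'p \<Rightarrow> bool" where
  "col \<equiv> collin L I"

definition lns :: "'p \<Rightarrow> 'l set" where
  "lns x = {l \<in> L. I x l}"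

definition perp :: "'p \<Rightarrow> 'p \<Rightarrow> 'p set" where
  "perp x y = {z \<in> P. col x z \<and> col y z}"

lemma card_points_on: "l \<in> L \<Longrightarrow> card {x \<in> P. I x l} = s + 1"
  using gq by (simp add: generalised_quadrangle_def)

lemma card_lns: "x \<in> P \<Longrightarrow> card (lns x) = t + 1"
  using gq by (simp add: generalised_quadrangle_def lns_def)

lemma finite_lns: "x \<in> P \<Longrightarrow> finite (lns x)"
  using card_lns[of x] by (intro card_ge_0_finite) simp

lemma line_unique:
  "\<lbrakk>x \<in> P; y \<in> P; l \<in> L; m \<in> L; x \<noteq> y; I x l; I y l; I x m; I y m\<rbrakk> \<Longrightarrow> l = m"
  using gq unfolding generalised_quadrangle_def by blast

lemma projection: "\<lbrakk>x \<in> P; l \<in> L; \<not> I x l\<rbrakk> \<Longrightarrow> \<exists>!y. y \<in> P \<and> I y l \<and> col x y"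
  using gq by (simp add: generalised_quadrangle_def)

lemma ex_line: "x \<in> P \<Longrightarrow> \<exists>l \<in> L. I x l"
proof -
  assume "x \<in> P"
  then have "lns x \<noteq> {}"
    using card_lns by fastforce
  then show ?thesis
    by (auto simp: lns_def)
qed

lemma col_refl: "x \<in> P \<Longrightarrow> col x x"
  using ex_line by (auto simp: collin_def)

lemma colI: "\<lbrakk>l \<in> L; I x l; I y l\<rbrakk> \<Longrightarrow> col x y"
  by (auto simp: collin_def)

text \<open>If \<open>z\<close> were off \<open>l\<close>, both \<open>x\<close> and
  \<open>y\<close> would be its projection on \<open>l\<close>, against uniqueness.\<close>

lemma no_triangle:
  "\<lbrakk>x \<in> P; y \<in> P; z \<in> P; l \<in> L; I x l; I y l; x \<noteq> y; col z x; col z y\<rbrakk> \<Longrightarrow> I z l"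
  using projection[of z l] by blast

lemma perp_alt: "perp x y = {z \<in> P. col z x \<and> col z y}"
  by (auto simp: perp_def collin_def)

lemma finite_lines: "finite L"
proof -
  have "L \<subseteq> (\<Union>x\<in>P. lns x)"
  proof
    fix l assume "l \<in> L"
    then have "{x \<in> P. I x l} \<noteq> {}"
      using card_points_on by (metis Suc_eq_plus1 card.empty nat.distinct(1))
    then show "l \<in> (\<Union>x\<in>P. lns x)"
      using \<open>l \<in> L\<close> by (auto simp: lns_def)
  qed
  moreover have "finite (\<Union>x\<in>P. lns x)"
    using finite_lns by auto
  ultimately show ?thesis
    by (rule finite_subset)
qed

text \<open>The lines of \<open>M\<close> meet pairwise only in \<open>u\<close>, so without
  \<open>u\<close> they are disjoint sets of \<open>s\<close> points. Below, \<open>M\<close> is the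
  full pencil at \<open>u\<close> or the pencil with one or two lines removed.\<close>

lemma card_fan:
  assumes u: "u \<in> P" and M: "M \<subseteq> lns u"
  shows "card {z \<in> P. z \<noteq> u \<and> (\<exists>l\<in>M. I z l)} = card M * s"
proof -
  have fin: "finite M"
    using M finite_lns[OF u] by (rule finite_subset)
  have "{z \<in> P. z \<noteq> u \<and> (\<exists>l\<in>M. I z l)} = (\<Union>l\<in>M. {z \<in> P. I z l} - {u})"
    by auto
  also have "card \<dots> = (\<Sum>l\<in>M. card ({z \<in> P. I z l} - {u}))"
  proof (rule card_UN_disjoint)
    show "\<forall>l\<in>M. \<forall>m\<in>M. l \<noteq> m \<longrightarrow>
            ({z \<in> P. I z l} - {u}) \<inter> ({z \<in> P. I z m} - {u}) = {}"
      using line_unique[OF u] M unfolding lns_def by blast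
  qed (use fin in auto)
  also have "\<dots> = (\<Sum>l\<in>M. s)"
  proof (rule sum.cong)
    fix l assume "l \<in> M"
    then have "l \<in> L" "I u l"
      using M by (auto simp: lns_def)
    then show "card ({z \<in> P. I z l} - {u}) = s"
      using card_points_on[of l] u by (simp add: card_Diff_singleton)
  qed simp
  finally show ?thesis
    by simp
qed

lemma card_neighbours:
  assumes "u \<in> P"
  shows "card {z \<in> P. z \<noteq> u \<and> col u z} = (t + 1) * s"
proof -
  have "{z \<in> P. z \<noteq> u \<and> col u z} = {z \<in> P. z \<noteq> u \<and> (\<exists>l\<in>lns u. I z l)}"
    by (auto simp: collin_def lns_def)
  then show ?thesis
    using card_fan[OF assms, of "lns u"] card_lns[OF assms] by simp
qed

lemma card_closed_neighbours:
  assumes "u \<in> P"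
  shows "card {z \<in> P. col u z} = (t + 1) * s + 1"
proof -
  have "{z \<in> P. col u z} = insert u {z \<in> P. z \<noteq> u \<and> col u z}"
    using col_refl assms by auto
  then show ?thesis
    using card_neighbours[OF assms] by simp
qed

text \<open>Each of the \<open>t + 1\<close> lines through \<open>x\<close> carries exactly one
  point collinear with \<open>y\<close>, and each common neighbour lies on exactly one of these
  lines.\<close>

lemma card_perp:
  assumes x: "x \<in> P" and y: "y \<in> P" and xy: "\<not> col x y"
  shows "card (perp x y) = t + 1"
proof -
  have "(\<Sum>l\<in>lns x. card {z \<in> perp x y. I z l}) = 1 * card (perp x y)"
  proof (rule sum_multicount)
    show "\<forall>z\<in>perp x y. card {l \<in> lns x. I z l} = 1"
    proof
      fix z assume z: "z \<in> perp x y"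
      then have zP: "z \<in> P" and zx: "col x z" and zy: "col y z"
        by (auto simp: perp_def)
      have "z \<noteq> x"
        using zy xy collin_sym by metis
      then have "\<exists>!l. l \<in> lns x \<and> I z l"
        using line_unique[OF x zP] zx unfolding lns_def collin_def by blast
      then show "card {l \<in> lns x. I z l} = 1"
        by (simp only: card_eq_1_iff_ex1)
    qed
  qed (use x finite_lns in auto)
  moreover have "card {z \<in> perp x y. I z l} = 1" if "l \<in> lns x" for l
  proof -
    have l: "l \<in> L" "I x l"
      using that by (auto simp: lns_def)
    then have "\<not> I y l"
      using xy colI by blast
    then have "\<exists>!z. z \<in> P \<and> I z l \<and> col y z"
      using projection y l by blast
    then have "\<exists>!z. z \<in> perp x y \<and> I z l"
      using colI[OF l] unfolding perp_def by blast
    then show ?thesis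
      by (simp only: card_eq_1_iff_ex1)
  qed
  ultimately show ?thesis
    using card_lns[OF x] by simp
qed

lemma perp_collinear:
  assumes x: "x \<in> P" and y: "y \<in> P" and "x \<noteq> y" and l: "l \<in> L" "I x l" "I y l"
  shows "perp x y = {z \<in> P. I z l}"
  using no_triangle[OF x y _ l(1,2,3) \<open>x \<noteq> y\<close>] colI[OF l(1)] l collin_sym[of L I]
  unfolding perp_def by blast

text \<open>Project the points off a fixed line \<open>l\<close> onto \<open>l\<close>: the fibre
  over \<open>u\<close> consists of the points other than \<open>u\<close> on the \<open>t\<close>
  further lines through \<open>u\<close>.\<close>

lemma card_points: "card P = (s + 1) * (s * t + 1)"
proof -
  obtain p where "p \<in> P"
    using gq by (auto simp: generalised_quadrangle_def)
  then obtain l where l: "l \<in> L"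
    using ex_line by blast
  let ?S = "{x \<in> P. I x l}" and ?T = "{x \<in> P. \<not> I x l}"
  have "(\<Sum>u\<in>?S. card {z \<in> ?T. col z u}) = 1 * card ?T"
  proof (rule sum_multicount)
    show "\<forall>z\<in>?T. card {u \<in> ?S. col z u} = 1"
    proof
      fix z assume "z \<in> ?T"
      then have "\<exists>!u. u \<in> ?S \<and> col z u"
        using projection[of z l] l by simp
      then show "card {u \<in> ?S. col z u} = 1"
        by (simp only: card_eq_1_iff_ex1)
    qed
  qed simp_all
  moreover have "card {z \<in> ?T. col z u} = t * s" if "u \<in> ?S" for u
  proof -
    have u: "u \<in> P" "I u l"
      using that by auto
    have "{z \<in> ?T. col z u} = {z \<in> P. z \<noteq> u \<and> (\<exists>m\<in>lns u - {l}. I z m)}"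
      using line_unique[OF u(1) _ l _ _ u(2)] u l unfolding lns_def collin_def by blast
    moreover have "card (lns u - {l}) = t"
      using card_lns[OF u(1)] u l by (simp add: card_Diff_singleton lns_def)
    ultimately show ?thesis
      using card_fan[OF u(1), of "lns u - {l}"] by auto
  qed
  ultimately have "card ?T = (s + 1) * (t * s)"
    using card_points_on[OF l] by simp
  moreover have "card P = card ?S + card ?T"
    by (subst card_Un_disjoint[symmetric]) (auto intro: arg_cong[where f = card])
  ultimately show ?thesis
    using card_points_on[OF l] by (simp add: algebra_simps)
qed

lemma card_lines: "(s + 1) * card L = (t + 1) * card P"
proof -
  have "(\<Sum>l\<in>L. card {x \<in> P. I x l}) = (t + 1) * card P"
    by (rule sum_multicount) (use finite_lines card_lns in \<open>auto simp: lns_def\<close>)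
  then show ?thesis
    using card_points_on by (simp add: mult.commute)
qed

end

section \<open>Triads in quadrangles of order \<open>(s, s^2)\<close>\<close>

locale gq_square = gen_quadrangle P L I s "s\<^sup>2"
  for P :: "'p::finite set" and L :: "'l set" and I s
begin

text \<open>Double counting of pairs and triples shows that the numbers of centres of the triads on
  \<open>x, y\<close> have mean \<open>s + 1\<close> and variance \<open>0\<close>.\<close>

lemma card_triad_centres:
  assumes x: "x \<in> P" and y: "y \<in> P" and xy: "\<not> col x y"
    and w: "w \<in> P" "\<not> col x w" "\<not> col y w"
  shows "card {u \<in> perp x y. col w u} = s + 1"
proof -
  define C where "C = perp x y"
  define Z where "Z = {z \<in> P. \<not> col x z \<and> \<not> col y z}"
  define c where "c z = card {u \<in> C. col z u}" for z
  have cardC: "card C = s\<^sup>2 + 1"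
    unfolding C_def using card_perp[OF x y xy] .
  have C: "u \<in> P" "col x u" "col y u" "u \<noteq> x" "u \<noteq> y" if "u \<in> C" for u
    using that xy collin_sym[of L I x y] unfolding C_def perp_def by auto
  \<comment> \<open>A line joining two points of \<open>C\<close> would contain both
    \<open>x\<close> and \<open>y\<close>.\<close>
  have Cnc: "\<not> col u v" if "u \<in> C" "v \<in> C" "u \<noteq> v" for u v
  proof
    assume "col u v"
    then obtain l where l: "l \<in> L" "I u l" "I v l"
      by (auto simp: collin_def)
    have "I x l" "I y l"
      using no_triangle[of u v x l] no_triangle[of u v y l] that C l x y by auto
    then show False
      using xy colI l by blast
  qed

  \<comment> \<open>Inclusion-exclusion for the closed neighbourhoods of \<open>x\<close> and
    \<open>y\<close>, stated over the integers because of the negative terms.\<close>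
  have cardZ: "int (card Z) = int s ^ 4 - int s ^ 3 + int s ^ 2 - int s"
  proof -
    let ?X = "{z \<in> P. col x z}" and ?Y = "{z \<in> P. col y z}"
    have "card ?X + card ?Y = card (?X \<union> ?Y) + card (?X \<inter> ?Y)"
      by (rule card_Un_Int) simp_all
    moreover have "?X \<inter> ?Y = C"
      by (auto simp: C_def perp_def)
    moreover have "card P = card (?X \<union> ?Y) + card Z"
      by (subst card_Un_disjoint[symmetric])
        (auto simp: Z_def intro: arg_cong[where f = card])
    ultimately have "card Z + 2 * ((s\<^sup>2 + 1) * s + 1) = (s + 1) * (s * s\<^sup>2 + 1) + (s\<^sup>2 + 1)"
      using card_closed_neighbours[OF x] card_closed_neighbours[OF y] cardC card_points by simp
    then have "int (card Z) + 2 * ((int s ^ 2 + 1) * int s + 1)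
        = (int s + 1) * (int s * int s ^ 2 + 1) + (int s ^ 2 + 1)"
      by (metis (mono_tags, lifting) of_nat_1 of_nat_add of_nat_mult of_nat_numeral of_nat_power)
    then show ?thesis
      by (simp add: algebra_simps power2_eq_square power3_eq_cube power4_eq_xxxx)
  qed

  \<comment> \<open>Of the \<open>s^2 + 1\<close> lines through \<open>u\<close>, those to
    \<open>x\<close> and \<open>y\<close> contain no point of \<open>Z\<close>; on each of the
    others every point except \<open>u\<close> is in \<open>Z\<close>.\<close>
  have sum1: "(\<Sum>z\<in>Z. c z) = ((s\<^sup>2 - 1) * s) * card C"
    unfolding c_def
  proof (rule sum_multicount)
    show "\<forall>u\<in>C. card {z \<in> Z. col z u} = (s\<^sup>2 - 1) * s"
    proof
      fix u assume u: "u \<in> C"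
      obtain l where l: "l \<in> L" "I x l" "I u l"
        using C[OF u] by (auto simp: collin_def)
      obtain m where m: "m \<in> L" "I y m" "I u m"
        using C[OF u] by (auto simp: collin_def)
      have "l \<noteq> m"
        using l m xy colI by blast
      have "{z \<in> Z. col z u} = {z \<in> P. z \<noteq> u \<and> (\<exists>k\<in>lns u - {l, m}. I z k)}"
      proof (intro set_eqI iffI)
        fix z assume "z \<in> {z \<in> Z. col z u}"
        then have z: "z \<in> P" "\<not> col x z" "\<not> col y z" "col z u"
          by (auto simp: Z_def)
        then obtain k where k: "k \<in> L" "I z k" "I u k"
          by (auto simp: collin_def)
        have "k \<noteq> l" "k \<noteq> m" "z \<noteq> u"
          using z k l m colI C[OF u] by blast+
        then show "z \<in> {z \<in> P. z \<noteq> u \<and> (\<exists>k\<in>lns u - {l, m}. I z k)}"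
          using z k by (auto simp: lns_def)
      next
        fix z assume "z \<in> {z \<in> P. z \<noteq> u \<and> (\<exists>k\<in>lns u - {l, m}. I z k)}"
        then obtain k where k: "z \<in> P" "z \<noteq> u" "k \<in> L" "I u k" "k \<noteq> l" "k \<noteq> m" "I z k"
          by (auto simp: lns_def)
        then have zu: "col z u"
          using colI by blast
        have "\<not> I z l" "\<not> I z m"
          using line_unique[of z u k l] line_unique[of z u k m] k l m C(1)[OF u] by blast+
        then have "\<not> col x z" "\<not> col y z"
          using no_triangle[of x u z l] no_triangle[of y u z m] k C[OF u] l m x y zu
            collin_sym[of L I z] by metis+
        then show "z \<in> {z \<in> Z. col z u}"
          using k zu by (simp add: Z_def)
      qed
      moreover have "card (lns u - {l, m}) = s\<^sup>2 - 1"
        using card_lns[OF C(1)[OF u]] l m \<open>l \<noteq> m\<close>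
        by (subst card_Diff_subset) (auto simp: lns_def)
      ultimately show "card {z \<in> Z. col z u} = (s\<^sup>2 - 1) * s"
        using card_fan[OF C(1)[OF u], of "lns u - {l, m}"] by auto
    qed
  qed simp_all

  let ?D = "{(u, v). u \<in> C \<and> v \<in> C \<and> u \<noteq> v}"
  \<comment> \<open>Two distinct points \<open>u\<close>, \<open>v\<close> of \<open>C\<close> have
    \<open>s^2 + 1\<close> common neighbours; two of these are \<open>x\<close> and
    \<open>y\<close>, and the others all lie in \<open>Z\<close>.\<close>
  have "(\<Sum>z\<in>Z. card {p \<in> ?D. col z (fst p) \<and> col z (snd p)}) = (s\<^sup>2 - 1) * card ?D"
  proof (rule sum_multicount)
    show "\<forall>p\<in>?D. card {z \<in> Z. col z (fst p) \<and> col z (snd p)} = s\<^sup>2 - 1"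
    proof safe
      fix u v assume uv: "u \<in> C" "v \<in> C" "u \<noteq> v"
      have nc: "\<not> col u v"
        using Cnc uv .
      \<comment> \<open>Distinct common neighbours of \<open>u\<close> and \<open>v\<close> are not
        collinear, since the line joining them would contain both \<open>u\<close> and
        \<open>v\<close>.\<close>
      have *: "\<not> col a z"
        if "z \<in> P" "z \<noteq> a" "col z u" "col z v" "a \<in> P" "col a u" "col a v" for z a
      proof
        assume "col a z"
        then obtain l where l: "l \<in> L" "I a l" "I z l"
          by (auto simp: collin_def)
        have "I u l" "I v l"
          using no_triangle[of a z u l] no_triangle[of a z v l] that l uv C
            collin_sym[of L I] by metis+
        then show False
          using nc colI l by blast
      qed
      have "{z \<in> Z. col z u \<and> col z v} = perp u v - {x, y}"
        using *[of _ x] *[of _ y] C[OF uv(1)] C[OF uv(2)] x y col_refl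
        by (auto simp: Z_def perp_alt)
      moreover have "{x, y} \<subseteq> perp u v" "x \<noteq> y"
        using C[OF uv(1)] C[OF uv(2)] x y xy col_refl
        by (auto simp: perp_alt)
      ultimately show "card {z \<in> Z. col z (fst (u, v)) \<and> col z (snd (u, v))} = s\<^sup>2 - 1"
        using card_perp[of u v] C[OF uv(1)] C[OF uv(2)] nc by (simp add: card_Diff_subset)
    qed
  qed simp_all
  moreover have "card {p \<in> ?D. col z (fst p) \<and> col z (snd p)} = c z * (c z - 1)" for z
  proof -
    have "{p \<in> ?D. col z (fst p) \<and> col z (snd p)} =
        {(u, v). u \<in> {u \<in> C. col z u} \<and> v \<in> {u \<in> C. col z u} \<and> u \<noteq> v}"
      by auto
    then show ?thesis
      unfolding c_def by (simp only: card_off_diagonal[OF finite])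
  qed
  ultimately have sum2: "(\<Sum>z\<in>Z. c z * (c z - 1)) = (s\<^sup>2 - 1) * ((s\<^sup>2 + 1) * s\<^sup>2)"
    using card_off_diagonal[of C] cardC by simp

  \<comment> \<open>Expand the square in terms of \<open>c z * (c z - 1)\<close> and
    \<open>c z\<close>, whose sums are known. The case \<open>s = 0\<close> is separate because
    \<open>s^2 - 1\<close> is truncated there.\<close>
  have "(\<Sum>z\<in>Z. (int (c z) - (int s + 1))\<^sup>2) = 0"
  proof (cases "s = 0")
    case True
    then have "card Z = 0"
      using cardZ by simp
    then show ?thesis
      by simp
  next
    case False
    then have s: "int (s\<^sup>2 - 1) = int s ^ 2 - 1"
      by (simp add: of_nat_diff)
    have "(int (c z) - (int s + 1))\<^sup>2 =
        int (c z * (c z - 1)) - (2 * int s + 1) * int (c z) + (int s + 1)\<^sup>2" for z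
      by (cases "c z") (simp_all add: power2_eq_square algebra_simps)
    then have "(\<Sum>z\<in>Z. (int (c z) - (int s + 1))\<^sup>2) =
        int (\<Sum>z\<in>Z. c z * (c z - 1)) - (2 * int s + 1) * int (\<Sum>z\<in>Z. c z)
          + int (card Z) * (int s + 1)\<^sup>2"
      by (simp add: sum.distrib sum_subtractf sum_distrib_left)
    also have "\<dots> = (int s ^ 2 - 1) * ((int s ^ 2 + 1) * int s ^ 2)
        - (2 * int s + 1) * ((int s ^ 2 - 1) * int s * (int s ^ 2 + 1))
        + (int s ^ 4 - int s ^ 3 + int s ^ 2 - int s) * (int s + 1)\<^sup>2"
      unfolding sum1 sum2 cardC cardZ of_nat_mult s by (simp add: add.commute)
    also have "\<dots> = 0"
      by algebra
    finally show ?thesis .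
  qed
  then have "\<forall>z\<in>Z. (int (c z) - (int s + 1))\<^sup>2 = 0"
    by (subst (asm) sum_nonneg_eq_0_iff) auto
  moreover have "w \<in> Z"
    using w by (simp add: Z_def)
  ultimately show ?thesis
    unfolding c_def C_def by auto
qed

end

section \<open>Doubly subtended subquadrangles\<close>

locale doubly_subtended_gq =
  fixes P P' :: "'p::finite set" and L L' :: "'l set" and I :: "'p \<Rightarrow> 'l \<Rightarrow> bool" and s :: nat
  assumes s2: "s > 1"
    and gqQ: "generalised_quadrangle P L I s (s\<^sup>2)"
    and subQ: "subquadrangle P' L' P L I s s"
    and ds: "doubly_subtended P' P L I"
begin

sublocale Q: gq_square P L I s
  using gqQ by unfold_locales

sublocale Q': gen_quadrangle P' L' I s s
  using subQ by unfold_locales (simp add: subquadrangle_def)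

abbreviation "\<Omega> \<equiv> P - P'"
abbreviation "\<O> \<equiv> subtended P' L I"
abbreviation "R \<equiv> PW_rel P' P L I s"

lemma sub_points: "x \<in> P' \<Longrightarrow> x \<in> P" and sub_lines: "l \<in> L' \<Longrightarrow> l \<in> L"
  using subQ by (auto simp: subquadrangle_def)

text \<open>A line of \<open>L'\<close> has \<open>s + 1\<close> points in either quadrangle, so
  those in \<open>P'\<close> already exhaust it.\<close>

lemma points_on_sub_line:
  assumes "l \<in> L'" "x \<in> P" "I x l"
  shows "x \<in> P'"
proof -
  have "{x \<in> P'. I x l} = {x \<in> P. I x l}"
    by (rule card_subset_eq)
      (use sub_points Q.card_points_on[OF sub_lines] Q'.card_points_on assms(1) in auto)
  then show ?thesis
    using assms by blast
qed

text \<open>Take a line \<open>m\<close> of \<open>L'\<close> through \<open>y\<close>. If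
  \<open>x\<close> is off \<open>m\<close>, its projection on \<open>m\<close> within the
  subquadrangle is also its projection in the large one, hence equals \<open>y\<close>; the joining
  line in \<open>L'\<close> is then \<open>l\<close>.\<close>

lemma line_through_sub_points:
  assumes x: "x \<in> P'" and y: "y \<in> P'" and "x \<noteq> y" and l: "l \<in> L" "I x l" "I y l"
  shows "l \<in> L'"
proof -
  obtain m where m: "m \<in> L'" "I y m"
    using Q'.ex_line y by blast
  show ?thesis
  proof (cases "I x m")
    case True
    then have "m = l"
      using Q.line_unique[of x y m l] assms m sub_points sub_lines by blast
    then show ?thesis
      using m by simp
  next
    case False
    then obtain y' where y': "y' \<in> P'" "I y' m" "collin L' I x y'"
      using Q'.projection[of x m] x m by blast
    then obtain n where n: "n \<in> L'" "I x n" "I y' n"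
      by (auto simp: collin_def)
    have "Q.col x y'" "Q.col x y"
      using n l sub_lines Q.colI by blast+
    then have "y' = y"
      using Q.projection[of x m] False x y y' m sub_points sub_lines by blast
    then have "n = l"
      using Q.line_unique[of x y n l] assms n sub_points sub_lines by blast
    then show ?thesis
      using n by simp
  qed
qed

lemma outer_line_meets_once:
  assumes X: "X \<in> \<Omega>" and l: "l \<in> L" "I X l" and "z \<in> P'" "z' \<in> P'" "I z l" "I z' l"
  shows "z = z'"
  using line_through_sub_points[of z z' l] points_on_sub_line[of l X] assms by blast

text \<open>\<open>\<O> X\<close> is an ovoid: each line of \<open>L'\<close> contains exactly one
  of its points, the projection of \<open>X\<close>. Counting flags gives
  \<open>(s + 1) * card (\<O> X) = card L'\<close>, and \<open>card L' = card P'\<close> because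
  both parameters are \<open>s\<close>.\<close>

lemma card_subtended:
  assumes X: "X \<in> \<Omega>"
  shows "card (\<O> X) = s\<^sup>2 + 1"
proof -
  have "(\<Sum>l\<in>L'. card {z \<in> \<O> X. I z l}) = (s + 1) * card (\<O> X)"
    by (rule sum_multicount)
      (use Q'.finite_lines Q'.card_lns in \<open>auto simp: subtended_def Q'.lns_def\<close>)
  moreover have "card {z \<in> \<O> X. I z l} = 1" if l: "l \<in> L'" for l
  proof -
    have "\<not> I X l"
      using points_on_sub_line X l by blast
    then have "\<exists>!z. z \<in> P \<and> I z l \<and> Q.col X z"
      using Q.projection X l sub_lines by blast
    then have "\<exists>!z. z \<in> \<O> X \<and> I z l"
      using points_on_sub_line[OF l] sub_points unfolding subtended_def by blast
    then show ?thesis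
      by (simp only: card_eq_1_iff_ex1)
  qed
  ultimately have "(s + 1) * card (\<O> X) = card L'"
    by simp
  moreover have "card L' = card P'"
    using Q'.card_lines by (metis Suc_eq_plus1 mult_cancel1 nat.distinct(1))
  moreover have "card P' = (s + 1) * (s\<^sup>2 + 1)"
    using Q'.card_points by (simp add: power2_eq_square)
  ultimately show ?thesis
    by (metis Suc_eq_plus1 mult_cancel1 nat.distinct(1))
qed

text \<open>The \<open>s^2 + 1\<close> lines through \<open>X\<close> carry at most one point of
  \<open>P'\<close> each and together cover the \<open>s^2 + 1\<close> points of
  \<open>\<O> X\<close>, so none of them can miss \<open>P'\<close>.\<close>

lemma outer_line_meets:
  assumes X: "X \<in> \<Omega>" and l: "l \<in> L" "I X l"
  shows "\<exists>!z. z \<in> P' \<and> I z l"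
proof -
  have XP: "X \<in> P"
    using X by simp
  have le: "card {z \<in> \<O> X. I z m} \<le> 1" if "m \<in> Q.lns X" for m
    using outer_line_meets_once[OF X, of m] that
    by (auto simp: card_le_Suc0_iff_eq subtended_def Q.lns_def)
  have "(\<Sum>m\<in>Q.lns X. card {z \<in> \<O> X. I z m}) = 1 * card (\<O> X)"
  proof (rule sum_multicount)
    show "\<forall>z\<in>\<O> X. card {m \<in> Q.lns X. I z m} = 1"
    proof
      fix z assume "z \<in> \<O> X"
      then have z: "z \<in> P" "z \<noteq> X" "Q.col X z"
        using X sub_points by (auto simp: subtended_def)
      then have "\<exists>!m. m \<in> Q.lns X \<and> I z m"
        using Q.line_unique[OF XP z(1)] unfolding Q.lns_def collin_def by blast
      then show "card {m \<in> Q.lns X. I z m} = 1"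
        by (simp only: card_eq_1_iff_ex1)
    qed
  qed (use Q.finite_lns[OF XP] in auto)
  also have "\<dots> = (\<Sum>m\<in>Q.lns X. 1)"
    using Q.card_lns[OF XP] card_subtended[OF X] by simp
  finally have "card {z \<in> \<O> X. I z l} = 1"
    by (rule sum_mono_inv) (use le l Q.finite_lns[OF XP] in \<open>auto simp: Q.lns_def\<close>)
  then obtain z where "z \<in> P'" "I z l"
    by (auto simp: card_1_singleton_iff subtended_def)
  then show ?thesis
    using outer_line_meets_once[OF X l] by blast
qed

text \<open>The common neighbours of \<open>X\<close> and \<open>Y\<close> are the points of the
  line joining them, and this line meets \<open>P'\<close> exactly once.\<close>

lemma card_subtended_Int_collinear:
  assumes X: "X \<in> \<Omega>" and Y: "Y \<in> \<Omega>" and "X \<noteq> Y" "Q.col X Y"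
  shows "card (\<O> X \<inter> \<O> Y) = 1"
proof -
  obtain l where l: "l \<in> L" "I X l" "I Y l"
    using assms by (auto simp: collin_def)
  have "\<O> X \<inter> \<O> Y = P' \<inter> Q.perp X Y"
    using sub_points by (auto simp: subtended_def Q.perp_def)
  also have "\<dots> = {z. z \<in> P' \<and> I z l}"
    using Q.perp_collinear[of X Y l] assms l sub_points by auto
  finally show ?thesis
    using outer_line_meets[OF X l(1,2)] by (simp only: card_eq_1_iff_ex1)
qed

text \<open>The description is meaningful on \<open>\<Omega>\<close> only, where
  \<open>doubly_subtended\<close> supplies existence and uniqueness. There it is a fixed-point-free
  involution whose graph is \<open>R 4\<close>.\<close>

definition mate :: "'p \<Rightarrow> 'p" where
  "mate X = (THE Y. Y \<in> \<Omega> \<and> Y \<noteq> X \<and> \<O> Y = \<O> X)"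

lemma mate:
  assumes "X \<in> \<Omega>"
  shows "mate X \<in> \<Omega>" "mate X \<noteq> X" "\<O> (mate X) = \<O> X"
proof -
  have "\<exists>!Y. Y \<in> \<Omega> \<and> Y \<noteq> X \<and> \<O> Y = \<O> X"
    using ds assms by (simp add: doubly_subtended_def)
  from theI'[OF this] show "mate X \<in> \<Omega>" "mate X \<noteq> X" "\<O> (mate X) = \<O> X"
    by (simp_all add: mate_def)
qed

lemma mate_unique:
  assumes "X \<in> \<Omega>" "Y \<in> \<Omega>" "Y \<noteq> X" "\<O> Y = \<O> X"
  shows "Y = mate X"
proof -
  have "\<exists>!Y. Y \<in> \<Omega> \<and> Y \<noteq> X \<and> \<O> Y = \<O> X"
    using ds assms(1) by (simp add: doubly_subtended_def)
  then show ?thesis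
    using mate[OF assms(1)] assms by blast
qed

lemma mate_mate: "X \<in> \<Omega> \<Longrightarrow> mate (mate X) = X"
  using mate[of X] mate_unique[of "mate X" X] by metis

text \<open>Otherwise the common ovoid, which has \<open>s^2 + 1\<close> points, would have only
  one.\<close>

lemma not_col_mate:
  assumes "X \<in> \<Omega>"
  shows "\<not> Q.col X (mate X)"
  using card_subtended_Int_collinear[OF assms mate(1)[OF assms]] mate(2,3)[OF assms]
    card_subtended[OF assms] s2 by auto

text \<open>The ovoid consists of common neighbours of \<open>X\<close> and its mate, and both sets
  have \<open>s^2 + 1\<close> elements.\<close>

lemma perp_mate:
  assumes "X \<in> \<Omega>"
  shows "Q.perp X (mate X) = \<O> X"
proof -
  have "\<O> X \<subseteq> Q.perp X (mate X)"
    using mate(3)[OF assms] sub_points by (auto simp: subtended_def Q.perp_def)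
  then show ?thesis
    using Q.card_perp[of X "mate X"] not_col_mate assms mate(1) card_subtended[OF assms]
    by (metis DiffD1 card_subset_eq finite)
qed

text \<open>The line \<open>X Y\<close> meets \<open>P'\<close> in a point \<open>z\<close> of the
  common ovoid. If the mate were collinear with \<open>Y\<close> as well as with \<open>z\<close>,
  it would lie on that line and be collinear with \<open>X\<close>.\<close>

lemma col_mate_imp_not_col:
  assumes X: "X \<in> \<Omega>" and Y: "Y \<in> \<Omega>" and "X \<noteq> Y" "Q.col X Y"
  shows "\<not> Q.col (mate X) Y"
proof
  assume c: "Q.col (mate X) Y"
  obtain l where l: "l \<in> L" "I X l" "I Y l"
    using assms by (auto simp: collin_def)
  obtain z where z: "z \<in> P'" "I z l"
    using outer_line_meets[OF X l(1,2)] by blast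
  have "z \<in> \<O> (mate X)"
    unfolding mate(3)[OF X] using z l Q.colI by (auto simp: subtended_def)
  then have "I (mate X) l"
    using Q.no_triangle[of z Y "mate X" l] z l c Y mate[OF X] sub_points
    by (auto simp: subtended_def)
  then show False
    using not_col_mate[OF X] Q.colI l by blast
qed

text \<open>By \<open>perp_mate\<close>, the intersection is the set of centres of the triad formed
  by \<open>X\<close>, \<open>mate X\<close> and \<open>Y\<close>.\<close>

lemma card_subtended_Int:
  assumes X: "X \<in> \<Omega>" and Y: "Y \<in> \<Omega>" and "\<not> Q.col X Y" "\<not> Q.col (mate X) Y"
  shows "card (\<O> X \<inter> \<O> Y) = s + 1"
proof -
  have "\<O> X \<inter> \<O> Y = {u \<in> Q.perp X (mate X). Q.col Y u}"
    unfolding perp_mate[OF X] by (auto simp: subtended_def)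
  then show ?thesis
    using Q.card_triad_centres[of X "mate X" Y] not_col_mate[OF X] mate[OF X] assms by simp
qed

section \<open>The relations expressed through collinearity and the involution\<close>

lemma R_subset: "(X, Y) \<in> R i \<Longrightarrow> X \<in> \<Omega> \<and> Y \<in> \<Omega>"
  by (auto simp: PW_rel_def)

lemma R_sym: "(X, Y) \<in> R i \<longleftrightarrow> (Y, X) \<in> R i"
  unfolding PW_rel_def using collin_sym[of L I X Y] by (auto simp: Int_commute)

lemma R0_iff: "X \<in> \<Omega> \<Longrightarrow> Y \<in> \<Omega> \<Longrightarrow> (X, Y) \<in> R 0 \<longleftrightarrow> X = Y"
  by (auto simp: PW_rel_def)

lemma R3_iff: "X \<in> \<Omega> \<Longrightarrow> Y \<in> \<Omega> \<Longrightarrow> (X, Y) \<in> R 3 \<longleftrightarrow> X \<noteq> Y \<and> Q.col X Y"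
  by (auto simp: PW_rel_def)

lemma R4_iff: "X \<in> \<Omega> \<Longrightarrow> Y \<in> \<Omega> \<Longrightarrow> (X, Y) \<in> R 4 \<longleftrightarrow> Y = mate X"
  using mate_unique[of X Y] mate[of X] by (auto simp: PW_rel_def)

lemma R4_iff_mate: "(X, Y) \<in> R 4 \<longleftrightarrow> X \<in> \<Omega> \<and> Y = mate X"
  using R_subset[of X Y 4] R4_iff[of X Y] mate(1)[of X] by blast

text \<open>For noncollinear \<open>X\<close> and \<open>Y\<close>, an intersection of size
  \<open>1\<close> rather than \<open>s + 1\<close> forces \<open>Y\<close> to be collinear with the
  mate of \<open>X\<close>. The converse holds since the mate subtends the same ovoid.\<close>

lemma R1_iff:
  assumes X: "X \<in> \<Omega>" and Y: "Y \<in> \<Omega>"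
  shows "(X, Y) \<in> R 1 \<longleftrightarrow> (mate X, Y) \<in> R 3"
proof
  assume "(X, Y) \<in> R 1"
  then have nc: "\<not> Q.col X Y" and c1: "card (\<O> X \<inter> \<O> Y) = 1"
    by (auto simp: PW_rel_def)
  have "Q.col (mate X) Y"
    using card_subtended_Int[OF X Y nc] c1 s2 by auto
  moreover have "mate X \<noteq> Y"
    using c1 mate[OF X] card_subtended[OF X] s2 by auto
  ultimately show "(mate X, Y) \<in> R 3"
    using R3_iff mate[OF X] Y by simp
next
  assume "(mate X, Y) \<in> R 3"
  then have "mate X \<noteq> Y" "Q.col (mate X) Y"
    using R3_iff mate[OF X] Y by simp_all
  then have "card (\<O> X \<inter> \<O> Y) = 1" "\<not> Q.col X Y"
    using card_subtended_Int_collinear[of "mate X" Y] col_mate_imp_not_col[of "mate X" Y]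
      mate[OF X] mate_mate[OF X] Y by auto
  then show "(X, Y) \<in> R 1"
    using X Y by (simp add: PW_rel_def)
qed

text \<open>This makes \<open>R 2\<close> the complement of the other four relations. The bound
  \<open>s > 1\<close> separates \<open>s + 1\<close> from \<open>s^2 + 1\<close>, the size of the
  intersection for mates.\<close>

lemma R2_iff:
  assumes X: "X \<in> \<Omega>" and Y: "Y \<in> \<Omega>"
  shows "(X, Y) \<in> R 2 \<longleftrightarrow> X \<noteq> Y \<and> Y \<noteq> mate X \<and> (X, Y) \<notin> R 3 \<and> (mate X, Y) \<notin> R 3"
proof
  assume "(X, Y) \<in> R 2"
  then have nc: "\<not> Q.col X Y" and c1: "card (\<O> X \<inter> \<O> Y) = s + 1"
    by (auto simp: PW_rel_def)
  have "X \<noteq> Y"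
    using nc Q.col_refl X by auto
  moreover have "Y \<noteq> mate X"
    using c1 mate(3)[OF X] card_subtended[OF X] s2 by (auto simp: power2_eq_square)
  moreover have "(X, Y) \<notin> R 1"
    using c1 s2 by (auto simp: PW_rel_def)
  ultimately show "X \<noteq> Y \<and> Y \<noteq> mate X \<and> (X, Y) \<notin> R 3 \<and> (mate X, Y) \<notin> R 3"
    using R1_iff[OF X Y] R3_iff[OF X Y] nc by auto
next
  assume *: "X \<noteq> Y \<and> Y \<noteq> mate X \<and> (X, Y) \<notin> R 3 \<and> (mate X, Y) \<notin> R 3"
  then have nc: "\<not> Q.col X Y" "\<not> Q.col (mate X) Y"
    using R3_iff[OF X Y] R3_iff[OF mate(1)[OF X] Y] by auto
  then show "(X, Y) \<in> R 2"
    using card_subtended_Int[OF X Y nc] X Y by (simp add: PW_rel_def)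
qed

lemma R_disjoint:
  assumes X: "X \<in> \<Omega>" and Y: "Y \<in> \<Omega>" and "(X, Y) \<in> R 3"
  shows "X \<noteq> Y" "Y \<noteq> mate X" "(mate X, Y) \<notin> R 3"
  using R3_iff[OF X Y] R3_iff[OF mate(1)[OF X] Y] not_col_mate[OF X]
    col_mate_imp_not_col[OF X Y] assms by auto

lemma card_R3_row:
  assumes "X \<in> \<Omega>"
  shows "card {Z. (X, Z) \<in> R 3} = (s\<^sup>2 + 1) * (s - 1)"
proof -
  let ?N = "{z \<in> P. z \<noteq> X \<and> Q.col X z}"
  have "{Z. (X, Z) \<in> R 3} = ?N - \<O> X"
    using assms by (auto simp: PW_rel_def subtended_def)
  moreover have "\<O> X \<subseteq> ?N"
    using assms sub_points by (auto simp: subtended_def)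
  ultimately show ?thesis
    using Q.card_neighbours[of X] assms card_subtended[OF assms]
    by (simp add: card_Diff_subset diff_mult_distrib2)
qed

text \<open>From the common neighbours of \<open>X\<close> and \<open>Y\<close>, remove
  \<open>X\<close> and \<open>Y\<close> themselves and those in \<open>P'\<close>. In the collinear
  case these are the \<open>s + 1\<close> points of a line less \<open>X\<close>, \<open>Y\<close>
  and its point in \<open>P'\<close>. Real values avoid truncated subtraction.\<close>

lemma card_R3_R3:
  assumes X: "X \<in> \<Omega>" and Y: "Y \<in> \<Omega>" and "X \<noteq> Y"
  shows "real (card {Z. (X, Z) \<in> R 3 \<and> (Z, Y) \<in> R 3}) =
    (if (X, Y) \<in> R 3 then real s - 2 else real (s\<^sup>2 + 1) - real (card (\<O> X \<inter> \<O> Y)))"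
proof -
  have eq: "{Z. (X, Z) \<in> R 3 \<and> (Z, Y) \<in> R 3} = Q.perp X Y - {X, Y} - (\<O> X \<inter> \<O> Y)"
    using X Y collin_sym[of L I Y] by (auto simp: PW_rel_def subtended_def Q.perp_def)
  have sub: "\<O> X \<inter> \<O> Y \<subseteq> Q.perp X Y - {X, Y}"
    using X Y sub_points by (auto simp: subtended_def Q.perp_def)
  have card: "card {Z. (X, Z) \<in> R 3 \<and> (Z, Y) \<in> R 3} =
      card (Q.perp X Y - {X, Y}) - card (\<O> X \<inter> \<O> Y)"
    unfolding eq using sub by (simp add: card_Diff_subset)
  have le: "card (\<O> X \<inter> \<O> Y) \<le> card (Q.perp X Y - {X, Y})"
    using sub by (simp add: card_mono)
  show ?thesis
  proof (cases "Q.col X Y")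
    case True
    then obtain l where l: "l \<in> L" "I X l" "I Y l"
      by (auto simp: collin_def)
    have "Q.perp X Y = {z \<in> P. I z l}"
      using Q.perp_collinear[of X Y l] X Y \<open>X \<noteq> Y\<close> l by blast
    then have "card (Q.perp X Y - {X, Y}) = s - 1"
      using X Y l \<open>X \<noteq> Y\<close> Q.card_points_on[OF l(1)] by (simp add: card_Diff_subset)
    moreover have "card (\<O> X \<inter> \<O> Y) = 1"
      using card_subtended_Int_collinear assms True by blast
    ultimately show ?thesis
      using card s2 True R3_iff[OF X Y] \<open>X \<noteq> Y\<close> by (simp add: of_nat_diff)
  next
    case False
    then have "X \<notin> Q.perp X Y" "Y \<notin> Q.perp X Y"
      using collin_sym[of L I X Y] by (auto simp: Q.perp_def)
    then have "Q.perp X Y - {X, Y} = Q.perp X Y"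
      by blast
    then have "card (Q.perp X Y - {X, Y}) = s\<^sup>2 + 1"
      using Q.card_perp[of X Y] X Y False by simp
    then show ?thesis
      using card le False R3_iff[OF X Y] by (simp add: of_nat_diff)
  qed
qed

end

section \<open>The Bose--Mesner algebra\<close>

lemma adj_mat_mult:
  "(adj_mat S ** adj_mat T) $ x $ y = real (card {z. (x, z) \<in> S \<and> (z, y) \<in> T})"
proof -
  have "(adj_mat S ** adj_mat T) $ x $ y =
      (\<Sum>z\<in>UNIV. if (x, z) \<in> S \<and> (z, y) \<in> T then 1 else 0)"
    unfolding matrix_matrix_mult_def adj_mat_def by (simp, intro sum.cong) auto
  also have "\<dots> = real (card {z. (x, z) \<in> S \<and> (z, y) \<in> T})"
    by (simp add: sum.If_cases)
  finally show ?thesis .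
qed

lemma adj_mat_nth: "adj_mat S $ x $ y = (if (x, y) \<in> S then 1 else 0)"
  by (simp add: adj_mat_def)

lemma matrix_mult_diff_left: "(A - B) ** C = A ** C - B ** (C :: real ^ 'n ^ 'm::finite)"
  by (simp add: matrix_matrix_mult_def vec_eq_iff sum_subtractf left_diff_distrib)

lemma matrix_mult_add_left: "(A + B) ** C = A ** C + B ** (C :: real ^ 'n ^ 'm::finite)"
  by (simp add: matrix_matrix_mult_def vec_eq_iff sum.distrib distrib_right)

lemma matrix_mult_scaleR_left: "(c *\<^sub>R A) ** B = c *\<^sub>R (A ** (B :: real ^ 'n ^ 'm::finite))"
  by (simp add: matrix_matrix_mult_def vec_eq_iff sum_distrib_left mult.assoc)

lemma matrix_mult_scaleR_right: "A ** (c *\<^sub>R B) = c *\<^sub>R (A ** (B :: real ^ 'n ^ 'm::finite))"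
  by (simp add: matrix_matrix_mult_def vec_eq_iff sum_distrib_left mult_ac)

lemma matrix_mult_diff_right: "C ** (A - B) = C ** A - C ** (B :: real ^ 'n ^ 'm::finite)"
  by (simp add: matrix_matrix_mult_def vec_eq_iff sum_subtractf right_diff_distrib)

context doubly_subtended_gq
begin

abbreviation "\<A> \<equiv> bose_mesner 4 R"
abbreviation "A i \<equiv> adj_mat (R i)"
abbreviation "J \<equiv> adj_mat (\<Omega> \<times> \<Omega>)"

lemma A_in: "i \<le> 4 \<Longrightarrow> A i \<in> \<A>"
  unfolding bose_mesner_def by (rule span_base) auto

lemma bm_add: "M \<in> \<A> \<Longrightarrow> N \<in> \<A> \<Longrightarrow> M + N \<in> \<A>"
  and bm_diff: "M \<in> \<A> \<Longrightarrow> N \<in> \<A> \<Longrightarrow> M - N \<in> \<A>"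
  and bm_scale: "M \<in> \<A> \<Longrightarrow> c *\<^sub>R M \<in> \<A>"
  unfolding bose_mesner_def by (auto intro: span_add span_diff span_scale)

lemma bm_induct:
  assumes "M \<in> \<A>" "subspace {M. Q M}" "\<And>i. i \<le> 4 \<Longrightarrow> Q (A i)"
  shows "Q M"
proof -
  have "M \<in> span ((\<lambda>i. A i) ` {..4})"
    using assms(1) by (simp add: bose_mesner_def)
  then show ?thesis
    using assms(2) by (rule span_induct) (use assms(3) in auto)
qed

lemma bm_symmetric: "M \<in> \<A> \<Longrightarrow> transpose M = M"
proof (erule bm_induct)
  show "subspace {M :: real ^ 'p ^ 'p. transpose M = M}"
    by (auto simp: subspace_def transpose_def vec_eq_iff)
  show "transpose (A i) = A i" for i
    using R_sym by (simp add: transpose_def adj_mat_def vec_eq_iff)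
qed

text \<open>The five relations partition \<open>\<Omega> \<times> \<Omega>\<close>. In the closure
  proofs this trades \<open>A 2\<close> for \<open>J\<close>, whose products are easy.\<close>

lemma A2_eq: "A 2 = J - A 0 - A 1 - A 3 - A 4"
proof -
  have "A 2 $ x $ y = (J - A 0 - A 1 - A 3 - A 4) $ x $ y" for x y
  proof (cases "x \<in> \<Omega> \<and> y \<in> \<Omega>")
    case True
    then have X: "x \<in> \<Omega>" and Y: "y \<in> \<Omega>"
      by auto
    have "(mate x, y) \<in> R 3 \<Longrightarrow> x \<noteq> y \<and> y \<noteq> mate x"
      using R_disjoint[of "mate x" y] mate[OF X] mate_mate[OF X] Y by auto
    moreover have "x \<noteq> mate x"
      using mate(2)[OF X] by simp
    ultimately show ?thesis
      using R_disjoint[OF X Y] X Y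
      unfolding vector_minus_component adj_mat_nth R2_iff[OF X Y] R0_iff[OF X Y] R1_iff[OF X Y]
        R4_iff[OF X Y]
      by auto
  next
    case False
    then have "(x, y) \<notin> R i" for i
      using R_subset by blast
    then show ?thesis
      using False unfolding vector_minus_component adj_mat_nth by auto
  qed
  then show ?thesis
    by (simp add: vec_eq_iff)
qed

section \<open>Closure of the span under multiplication\<close>

lemma J_in: "J \<in> \<A>"
proof -
  have "J = A 2 + A 0 + A 1 + A 3 + A 4"
    using A2_eq by (simp add: algebra_simps)
  then show ?thesis
    by (simp only:) (intro bm_add A_in; simp)
qed

lemma bm_mult_leftI:
  assumes "M ** A 0 \<in> \<A>" "M ** A 4 \<in> \<A>" "M ** A 3 \<in> \<A>" "M ** A 1 \<in> \<A>" "M ** J \<in> \<A>"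
    and "N \<in> \<A>"
  shows "M ** N \<in> \<A>"
  using assms(6)
proof (rule bm_induct)
  show "subspace {N. M ** N \<in> \<A>}"
    using bm_add bm_scale span_zero[of "(\<lambda>i. A i) ` {..4}"]
    by (auto simp: subspace_def matrix_add_ldistrib matrix_mult_scaleR_right bose_mesner_def)
  fix i :: nat assume "i \<le> 4"
  then consider "i = 0" | "i = 1" | "i = 2" | "i = 3" | "i = 4"
    by linarith
  then show "M ** A i \<in> \<A>"
  proof cases
    case 3
    show ?thesis
      unfolding 3 A2_eq matrix_mult_diff_right by (intro bm_diff assms)
  qed (use assms in auto)
qed

lemma A0_mult: "A 0 ** adj_mat S = adj_mat {(x, y) \<in> S. x \<in> \<Omega>}"
proof -
  have "{z. (x, z) \<in> R 0 \<and> (z, y) \<in> S} = (if x \<in> \<Omega> \<and> (x, y) \<in> S then {x} else {})" for x y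
    by (auto simp: PW_rel_def)
  then show ?thesis
    by (simp add: vec_eq_iff adj_mat_mult adj_mat_nth)
qed

text \<open>On \<open>\<Omega>\<close>, \<open>A 4\<close> is the permutation matrix of
  \<open>mate\<close>, so it permutes rows.\<close>

lemma A4_mult: "A 4 ** adj_mat S = adj_mat {(x, y). x \<in> \<Omega> \<and> (mate x, y) \<in> S}"
proof -
  have "{z. (x, z) \<in> R 4 \<and> (z, y) \<in> S} =
      (if x \<in> \<Omega> \<and> (mate x, y) \<in> S then {mate x} else {})" for x y
    by (auto simp: R4_iff_mate)
  then show ?thesis
    by (simp add: vec_eq_iff adj_mat_mult adj_mat_nth)
qed

lemma A4_A3: "A 4 ** A 3 = A 1"
proof -
  have "{(x, y). x \<in> \<Omega> \<and> (mate x, y) \<in> R 3} = R 1"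
    using R1_iff R_subset mate by blast
  then show ?thesis
    by (simp add: A4_mult)
qed

lemma A3_A4: "A 3 ** A 4 = A 1"
proof -
  have "A 3 ** A 4 = transpose (A 4 ** A 3)"
    by (simp add: matrix_transpose_mul bm_symmetric A_in)
  then show ?thesis
    by (simp add: A4_A3 bm_symmetric A_in)
qed

lemma A4_J: "A 4 ** J = J"
proof -
  have "{(x, y). x \<in> \<Omega> \<and> (mate x, y) \<in> \<Omega> \<times> \<Omega>} = \<Omega> \<times> \<Omega>"
    using mate by auto
  then show ?thesis
    by (simp only: A4_mult)
qed

text \<open>Left multiplication by \<open>A 4\<close> interchanges \<open>A 0\<close> with
  \<open>A 4\<close> and \<open>A 1\<close> with \<open>A 3\<close>, and fixes
  \<open>J\<close>.\<close>

lemma A4_mult_in: "N \<in> \<A> \<Longrightarrow> A 4 ** N \<in> \<A>"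
proof (erule bm_mult_leftI[rotated 5])
  have "{(x, y). x \<in> \<Omega> \<and> (mate x, y) \<in> R 0} = R 4"
    using mate(1) by (auto simp: R4_iff_mate) (auto simp: PW_rel_def)
  then show "A 4 ** A 0 \<in> \<A>"
    by (simp add: A4_mult A_in)
  have "{(x, y). x \<in> \<Omega> \<and> (mate x, y) \<in> R 4} = R 0"
    using mate(1) mate_mate by (auto simp: R4_iff_mate) (auto simp: PW_rel_def)
  then show "A 4 ** A 4 \<in> \<A>"
    by (simp add: A4_mult A_in)
  have "(mate x, y) \<in> R 1 \<longleftrightarrow> (x, y) \<in> R 3" if "x \<in> \<Omega>" for x y
    using R1_iff[OF mate(1)[OF that], of y, unfolded mate_mate[OF that]]
      R_subset[of "mate x" y 1] R_subset[of x y 3] by blast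
  then have "{(x, y). x \<in> \<Omega> \<and> (mate x, y) \<in> R 1} = R 3"
    using R_subset[of _ _ 3] by blast
  then show "A 4 ** A 1 \<in> \<A>"
    by (simp add: A4_mult A_in)
qed (simp_all add: A4_A3 A4_J A_in J_in)

text \<open>The coefficients are the valency on the diagonal, \<open>(s^2 + 1) - 1\<close> on
  \<open>R 1\<close>, \<open>(s^2 + 1) - (s + 1)\<close> on \<open>R 2\<close> and
  \<open>s - 2\<close> on \<open>R 3\<close>. On \<open>R 4\<close> all \<open>s^2 + 1\<close>
  common neighbours lie in \<open>P'\<close>, so \<open>A 4\<close> does not occur.\<close>

lemma A3_A3:
  "A 3 ** A 3 = real ((s\<^sup>2 + 1) * (s - 1)) *\<^sub>R A 0 + (real s)\<^sup>2 *\<^sub>R A 1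
     + ((real s)\<^sup>2 - real s) *\<^sub>R A 2 + (real s - 2) *\<^sub>R A 3" (is "_ = ?M")
proof -
  have "(A 3 ** A 3) $ x $ y = ?M $ x $ y" for x y
  proof (cases "x \<in> \<Omega> \<and> y \<in> \<Omega>")
    case False
    then have "(x, y) \<notin> R i" and "\<not> ((x, z) \<in> R i \<and> (z, y) \<in> R i)" for i z
      using R_subset by blast+
    then show ?thesis
      by (simp add: adj_mat_mult adj_mat_nth)
  next
    case True
    then have X: "x \<in> \<Omega>" and Y: "y \<in> \<Omega>"
      by auto
    have d: "(mate x, y) \<in> R 3 \<Longrightarrow> x \<noteq> y \<and> y \<noteq> mate x"
      using R_disjoint[of "mate x" y] mate[OF X] mate_mate[OF X] Y by auto
    note iffs = R2_iff[OF X Y] R0_iff[OF X Y] R1_iff[OF X Y]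
    note dd = R_disjoint[OF X Y]
    consider "x = y" | "x \<noteq> y" "(x, y) \<in> R 3" | "x \<noteq> y" "(x, y) \<notin> R 3" "(x, y) \<in> R 1"
      | "x \<noteq> y" "(x, y) \<notin> R 3" "(x, y) \<in> R 2" | "x \<noteq> y" "(x, y) \<notin> R 3" "y = mate x"
      using iffs by blast
    then show ?thesis
    proof cases
      case 1
      then have "{z. (x, z) \<in> R 3 \<and> (z, y) \<in> R 3} = {z. (x, z) \<in> R 3}"
        using R_sym by blast
      then show ?thesis
        using 1 iffs dd d card_R3_row[OF X] by (auto simp: adj_mat_mult adj_mat_nth)
    next
      case 2
      then show ?thesis
        using iffs dd d card_R3_R3[OF X Y 2(1)] by (auto simp: adj_mat_mult adj_mat_nth)
    next
      case 3
      then have "card (\<O> x \<inter> \<O> y) = 1"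
        by (simp add: PW_rel_def)
      then show ?thesis
        using 3 iffs dd d card_R3_R3[OF X Y 3(1)] by (auto simp: adj_mat_mult adj_mat_nth)
    next
      case 4
      then have "card (\<O> x \<inter> \<O> y) = s + 1"
        by (simp add: PW_rel_def)
      then show ?thesis
        using 4 iffs dd d card_R3_R3[OF X Y 4(1)] by (auto simp: adj_mat_mult adj_mat_nth)
    next
      case 5
      then have "card (\<O> x \<inter> \<O> y) = s\<^sup>2 + 1"
        using card_subtended[OF X] mate[OF X] by simp
      then show ?thesis
        using 5 iffs dd d card_R3_R3[OF X Y 5(1)] by (auto simp: adj_mat_mult adj_mat_nth)
    qed
  qed
  then show ?thesis
    by (simp add: vec_eq_iff)
qed

lemma A3_J: "A 3 ** J = real ((s\<^sup>2 + 1) * (s - 1)) *\<^sub>R J"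
proof -
  have "card {z. (x, z) \<in> R 3 \<and> (z, y) \<in> \<Omega> \<times> \<Omega>} =
      (if (x, y) \<in> \<Omega> \<times> \<Omega> then (s\<^sup>2 + 1) * (s - 1) else 0)" for x y
  proof (cases "(x, y) \<in> \<Omega> \<times> \<Omega>")
    case True
    then have "{z. (x, z) \<in> R 3 \<and> (z, y) \<in> \<Omega> \<times> \<Omega>} = {z. (x, z) \<in> R 3}"
      using R_subset by blast
    then show ?thesis
      using True card_R3_row by auto
  next
    case False
    then have "{z. (x, z) \<in> R 3 \<and> (z, y) \<in> \<Omega> \<times> \<Omega>} = {}"
      using R_subset by blast
    then show ?thesis
      using False by (simp only: card.empty if_False)
  qed
  then show ?thesis
    unfolding vec_eq_iff vector_scaleR_component adj_mat_mult adj_mat_nth by simp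
qed

lemma A3_mult_in: "N \<in> \<A> \<Longrightarrow> A 3 ** N \<in> \<A>"
proof (erule bm_mult_leftI[rotated 5])
  have "A 3 ** A 0 = transpose (A 0 ** A 3)"
    by (simp add: matrix_transpose_mul bm_symmetric A_in)
  also have "\<dots> = A 3"
  proof -
    have "{(x, y) \<in> R 3. x \<in> \<Omega>} = R 3"
      using R_subset by blast
    then show ?thesis
      by (simp add: A0_mult bm_symmetric A_in)
  qed
  finally show "A 3 ** A 0 \<in> \<A>"
    by (simp add: A_in)
  show A33: "A 3 ** A 3 \<in> \<A>"
    unfolding A3_A3 by (intro bm_add bm_scale A_in; simp)
  \<comment> \<open>Writing \<open>A 1\<close> as \<open>A 4 ** A 3\<close> and moving
    \<open>A 4\<close> to the left reduces this product to the square of \<open>A 3\<close>.\<close>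
  have "A 3 ** A 1 = A 4 ** (A 3 ** A 3)"
  proof -
    have "A 3 ** A 1 = (A 3 ** A 4) ** A 3"
      by (simp only: A4_A3[symmetric] matrix_mul_assoc)
    also have "A 3 ** A 4 = A 4 ** A 3"
      by (simp only: A3_A4 A4_A3)
    finally show ?thesis
      by (simp only: matrix_mul_assoc)
  qed
  then show "A 3 ** A 1 \<in> \<A>"
    using A4_mult_in[OF A33] by simp
qed (simp_all add: A3_A4 A3_J A_in J_in bm_scale)

lemma J_mult_in: "N \<in> \<A> \<Longrightarrow> J ** N \<in> \<A>"
proof (erule bm_mult_leftI[rotated 5])
  \<comment> \<open>By symmetry the products with \<open>J\<close> on the left follow from those
    with \<open>J\<close> on the right.\<close>
  have *: "J ** A i = transpose (A i ** J)" if "i \<le> 4" for i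
    using that by (simp add: matrix_transpose_mul bm_symmetric A_in J_in)
  have "{(x, y) \<in> \<Omega> \<times> \<Omega>. x \<in> \<Omega>} = \<Omega> \<times> \<Omega>"
    by auto
  then show "J ** A 0 \<in> \<A>"
    by (simp only: * A0_mult bm_symmetric J_in)
  show "J ** A 4 \<in> \<A>"
    by (simp add: * A4_J bm_symmetric J_in)
  show J3: "J ** A 3 \<in> \<A>"
    by (simp add: * A3_J bm_symmetric J_in bm_scale)
  have "J ** A 1 = J ** A 3"
  proof -
    have "J ** A 1 = (J ** A 4) ** A 3"
      by (simp only: A4_A3[symmetric] matrix_mul_assoc)
    also have "J ** A 4 = J"
      by (simp add: * A4_J bm_symmetric J_in)
    finally show ?thesis .
  qed
  then show "J ** A 1 \<in> \<A>"
    using J3 by simp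
  have "J ** J = real (card \<Omega>) *\<^sub>R J"
  proof -
    have "card {z. (x, z) \<in> \<Omega> \<times> \<Omega> \<and> (z, y) \<in> \<Omega> \<times> \<Omega>} =
        (if (x, y) \<in> \<Omega> \<times> \<Omega> then card \<Omega> else 0)" for x y
      by (auto intro!: arg_cong[where f = card])
    then show ?thesis
      unfolding vec_eq_iff vector_scaleR_component adj_mat_mult adj_mat_nth by simp
  qed
  then show "J ** J \<in> \<A>"
    by (simp only: bm_scale J_in)
qed

lemma A_mult_in:
  assumes "i \<le> 4" "N \<in> \<A>"
  shows "A i ** N \<in> \<A>"
proof -
  have 0: "A 0 ** N \<in> \<A>"
    using assms(2)
  proof (rule bm_induct)
    show "subspace {N. A 0 ** N \<in> \<A>}"
      using bm_add bm_scale span_zero[of "(\<lambda>i. A i) ` {..4}"]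
      by (auto simp: subspace_def matrix_add_ldistrib matrix_mult_scaleR_right bose_mesner_def)
    show "A 0 ** A i \<in> \<A>" if "i \<le> 4" for i
    proof -
      have "{(x, y) \<in> R i. x \<in> \<Omega>} = R i"
        using R_subset by blast
      then show ?thesis
        using that by (simp only: A0_mult A_in)
    qed
  qed
  have 1: "A 1 ** N \<in> \<A>"
    unfolding A4_A3[symmetric] matrix_mul_assoc[symmetric]
    by (intro A4_mult_in A3_mult_in assms(2))
  have 2: "A 2 ** N \<in> \<A>"
    unfolding A2_eq matrix_mult_diff_left
    by (intro bm_diff J_mult_in 0 1 A3_mult_in A4_mult_in assms(2))
  consider "i = 0" | "i = 1" | "i = 2" | "i = 3" | "i = 4"
    using assms(1) by linarith
  then show ?thesis
    using 0 1 2 A3_mult_in A4_mult_in assms(2) by cases auto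
qed

lemma bm_mult:
  assumes "M \<in> \<A>" "N \<in> \<A>"
  shows "M ** N \<in> \<A>"
  using assms(1)
proof (rule bm_induct)
  show "subspace {M. M ** N \<in> \<A>}"
    using bm_add bm_scale span_zero[of "(\<lambda>i. A i) ` {..4}"]
    by (auto simp: subspace_def matrix_mult_add_left matrix_mult_scaleR_left bose_mesner_def)
qed (use A_mult_in assms(2) in auto)

text \<open>All elements of \<open>\<A>\<close> are symmetric, including the product, which
  therefore equals its transpose \<open>N ** M\<close>.\<close>

lemma bm_commute: "M \<in> \<A> \<Longrightarrow> N \<in> \<A> \<Longrightarrow> M ** N = N ** M"
  by (metis bm_mult bm_symmetric matrix_transpose_mul)

end

section \<open>Krein parameters and entrywise products\<close>

text \<open>The product of commuting idempotents is an idempotent below both factors. By minimality,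
  if nonzero it would equal \<open>e\<close> and also \<open>f\<close>.\<close>

lemma minimal_idempotents_orthogonal:
  assumes e: "minimal_idempotent \<A> e" and f: "minimal_idempotent \<A> f" and "e \<noteq> f"
    and closed: "e ** f \<in> \<A>" and comm: "e ** f = f ** e"
  shows "e ** f = 0"
proof -
  have ee: "e ** e = e" and ff: "f ** f = f"
    using e f by (auto simp: minimal_idempotent_def)
  have 1: "e ** (e ** f) = e ** f" "(e ** f) ** f = e ** f"
    by (metis ee matrix_mul_assoc, metis ff matrix_mul_assoc)
  have 2: "(e ** f) ** e = e ** f" "f ** (e ** f) = e ** f"
    by (metis 1 comm matrix_mul_assoc)+
  have 3: "(e ** f) ** (e ** f) = e ** f"
    by (metis 1 2 matrix_mul_assoc)
  have "e ** f = 0 \<or> e ** f = e" "e ** f = 0 \<or> e ** f = f"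
    using e f closed 1 2 3 unfolding minimal_idempotent_def by blast+
  then show ?thesis
    using \<open>e \<noteq> f\<close> by auto
qed

text \<open>A column is the image of a basis vector under \<open>A\<close>, so idempotence fixes it;
  linearity extends this to the span.\<close>

lemma col_space_fixed:
  assumes "A ** A = A" "u \<in> col_space A"
  shows "A *v u = u"
proof -
  have "u \<in> span (columns A)"
    using assms(2) by (simp add: col_space_def)
  then show ?thesis
  proof (rule span_induct)
    show "subspace {u. A *v u = u}"
      by (auto simp: subspace_def matrix_vector_right_distrib matrix_vector_mult_scaleR)
    fix v assume "v \<in> columns A"
    then obtain k where "v = A *v axis k 1"
      by (auto simp: columns_def matrix_vector_mult_basis)
    then show "A *v v = v"
      by (simp add: matrix_vector_mul_assoc assms(1))
  qed
qed

lemma sum_square_swap: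
  "(\<Sum>p\<in>S. (\<Sum>m\<in>T. f p m)\<^sup>2) = (\<Sum>m\<in>T. \<Sum>n\<in>T. \<Sum>p\<in>S. f p m * (f p n :: real))"
proof -
  have "(\<Sum>p\<in>S. (\<Sum>m\<in>T. f p m)\<^sup>2) = (\<Sum>p\<in>S. \<Sum>m\<in>T. \<Sum>n\<in>T. f p m * f p n)"
    by (simp add: power2_eq_square sum_product)
  also have "\<dots> = (\<Sum>m\<in>T. \<Sum>p\<in>S. \<Sum>n\<in>T. f p m * f p n)"
    by (rule sum.swap)
  also have "\<dots> = (\<Sum>m\<in>T. \<Sum>n\<in>T. \<Sum>p\<in>S. f p m * f p n)"
    by (rule sum.cong[OF refl], rule sum.swap)
  finally show ?thesis .
qed

lemma sum_triple_product:
  fixes a :: "'a::finite \<Rightarrow> real" and b :: "'b::finite \<Rightarrow> real" and c :: "'c::finite \<Rightarrow> real"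
  shows "(\<Sum>(y, x, z)\<in>UNIV. a y * b x * c z) = sum a UNIV * sum b UNIV * sum c UNIV"
proof -
  have "(\<Sum>(y, x, z)\<in>UNIV. a y * b x * c z) = (\<Sum>y\<in>UNIV. \<Sum>x\<in>UNIV. \<Sum>z\<in>UNIV. a y * b x * c z)"
    by (simp add: sum.cartesian_product UNIV_Times_UNIV[symmetric] del: UNIV_Times_UNIV)
  then show ?thesis
    by (simp only: sum_distrib_left[symmetric] sum_distrib_right[symmetric])
qed

lemma gram_symmetric_idempotent:
  assumes "transpose A = A" "A ** A = (A :: real ^ 'n ^ 'n::finite)"
  shows "(\<Sum>y\<in>UNIV. A $ m $ y * A $ n $ y) = A $ m $ n"
proof -
  have "A $ m $ n = (A ** transpose A) $ m $ n"
    by (simp add: assms)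
  then show ?thesis
    by (simp add: matrix_matrix_mult_def transpose_def)
qed

text \<open>The squared norms of the vectors \<open>H *v (a \<circ> b)\<close>, with \<open>a\<close>, \<open>b\<close> running over the columns
  of \<open>A\<close> and \<open>B\<close>, add up to the sum of the entries of \<open>H \<circ> A \<circ> B\<close>.\<close>

lemma schur_annihilated:
  fixes H A B :: "real ^ 'n ^ 'n::finite"
  assumes H: "transpose H = H" "H ** H = H"
    and A: "transpose A = A" "A ** A = A" and B: "transpose B = B" "B ** B = B"
    and sum0: "(\<Sum>m\<in>UNIV. \<Sum>n\<in>UNIV. H $ m $ n * schur_prod A B $ m $ n) = 0"
    and u: "u \<in> col_space A" and w: "w \<in> col_space B"
  shows "H *v (\<chi> m. u $ m * w $ m) = 0"
proof -
  \<comment> \<open>As \<open>H\<close> is symmetric, this is coordinate \<open>y\<close> of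
    \<open>H\<close> applied to the entrywise product of column \<open>x\<close> of \<open>A\<close>
    and column \<open>z\<close> of \<open>B\<close>.\<close>
  define r where "r = (\<lambda>(y, x, z). \<Sum>m\<in>UNIV. H $ m $ y * A $ m $ x * B $ m $ z)"
  have "(\<Sum>p\<in>UNIV. (r p)\<^sup>2) =
      (\<Sum>p\<in>UNIV. (\<Sum>m\<in>UNIV. (case p of (y, x, z) \<Rightarrow> H $ m $ y * A $ m $ x * B $ m $ z))\<^sup>2)"
    unfolding r_def by (intro sum.cong) (auto split: prod.split)
  also have "\<dots> = (\<Sum>m\<in>UNIV. \<Sum>n\<in>UNIV. \<Sum>(y, x, z)\<in>UNIV.
      (H $ m $ y * H $ n $ y) * (A $ m $ x * A $ n $ x) * (B $ m $ z * B $ n $ z))"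
    unfolding sum_square_swap by (intro sum.cong refl) (auto simp: mult_ac split: prod.split)
  also have "\<dots> = (\<Sum>m\<in>UNIV. \<Sum>n\<in>UNIV. H $ m $ n * schur_prod A B $ m $ n)"
    unfolding sum_triple_product gram_symmetric_idempotent[OF H] gram_symmetric_idempotent[OF A]
      gram_symmetric_idempotent[OF B] by (simp add: schur_prod_def mult.assoc)
  finally have "(\<Sum>p\<in>UNIV. (r p)\<^sup>2) = 0"
    using sum0 by simp
  then have "\<forall>p\<in>UNIV. (r p)\<^sup>2 = 0"
    by (subst (asm) sum_nonneg_eq_0_iff) auto
  then have r0: "(\<Sum>m\<in>UNIV. H $ m $ y * A $ m $ x * B $ m $ z) = 0" for x y z
    unfolding r_def by auto
  have Hsym: "H $ y $ m = H $ m $ y" for y m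
    using H(1) by (metis transpose_def vec_lambda_beta)
  have "(H *v (\<chi> m. u $ m * w $ m)) $ y = 0" for y
  proof -
    \<comment> \<open>Replacing \<open>u\<close> by \<open>A *v u\<close> and \<open>w\<close> by
      \<open>B *v w\<close> expands both in columns, so bilinearity reduces the claim to
      \<open>r0\<close>.\<close>
    have "(H *v (\<chi> m. u $ m * w $ m)) $ y = (H *v (\<chi> m. (A *v u) $ m * (B *v w) $ m)) $ y"
      by (simp add: col_space_fixed A B u w)
    also have "\<dots> = (\<Sum>m\<in>UNIV. H $ m $ y *
        ((\<Sum>x\<in>UNIV. A $ m $ x * u $ x) * (\<Sum>z\<in>UNIV. B $ m $ z * w $ z)))"
      by (simp add: matrix_vector_mult_def Hsym[of y])
    also have "\<dots> = (\<Sum>m\<in>UNIV. \<Sum>x\<in>UNIV. \<Sum>z\<in>UNIV.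
        H $ m $ y * ((A $ m $ x * u $ x) * (B $ m $ z * w $ z)))"
      unfolding sum_product by (simp only: sum_distrib_left)
    also have "\<dots> = (\<Sum>m\<in>UNIV. \<Sum>x\<in>UNIV. \<Sum>z\<in>UNIV.
        u $ x * w $ z * (H $ m $ y * A $ m $ x * B $ m $ z))"
      by (intro sum.cong refl) (simp add: mult_ac)
    also have "\<dots> = (\<Sum>x\<in>UNIV. \<Sum>z\<in>UNIV. u $ x * w $ z *
        (\<Sum>m\<in>UNIV. H $ m $ y * A $ m $ x * B $ m $ z))"
      unfolding sum_distrib_left
      by (subst sum.swap, rule sum.cong[OF refl], subst sum.swap, rule refl)
    finally show ?thesis
      by (simp add: r0)
  qed
  then show ?thesis
    by (simp add: vec_eq_iff)
qed

text \<open>Expanding \<open>schur_prod (E i) (E j)\<close> in the idempotents, orthogonality leaves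
  only the term \<open>k = h\<close> in the entry sum of its entrywise product with
  \<open>E h\<close>. That term is a multiple of \<open>q i j h\<close>, so
  \<open>schur_annihilated\<close> applies.\<close>

lemma krein_zero_annihilates:
  fixes E :: "nat \<Rightarrow> real ^ 'n ^ 'n::finite"
  assumes sym: "\<And>i. i \<le> d \<Longrightarrow> transpose (E i) = E i"
    and idem: "\<And>i. i \<le> d \<Longrightarrow> E i ** E i = E i"
    and orth: "\<And>i j. i \<le> d \<Longrightarrow> j \<le> d \<Longrightarrow> i \<noteq> j \<Longrightarrow> E i ** E j = 0"
    and krein: "krein_parameters \<Omega> d E q"
    and ijh: "i \<le> d" "j \<le> d" "h \<le> d" and q0: "q i j h = 0"
    and u: "u \<in> col_space (E i)" and w: "w \<in> col_space (E j)"
  shows "E h *v (\<chi> m. u $ m * w $ m) = 0"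
proof (rule schur_annihilated[OF _ _ _ _ _ _ _ u w])
  have tr: "(\<Sum>n\<in>UNIV. E h $ m $ n * E k $ m $ n) = (if k = h then E h $ m $ m else 0)"
    if "k \<le> d" for k m
  proof -
    have "(\<Sum>n\<in>UNIV. E h $ m $ n * E k $ m $ n) = (E h ** transpose (E k)) $ m $ m"
      by (simp add: matrix_matrix_mult_def transpose_def)
    then show ?thesis
      using that sym idem orth ijh by auto
  qed
  have "(\<Sum>m\<in>UNIV. \<Sum>n\<in>UNIV. E h $ m $ n * schur_prod (E i) (E j) $ m $ n) =
      (\<Sum>m\<in>UNIV. \<Sum>n\<in>UNIV. \<Sum>k\<le>d. q i j k / real (card \<Omega>) * (E h $ m $ n * E k $ m $ n))"
    using krein ijh unfolding krein_parameters_def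
    by (simp add: sum_distrib_left mult_ac)
  also have "\<dots> = (\<Sum>m\<in>UNIV. \<Sum>k\<le>d. q i j k / real (card \<Omega>) *
      (\<Sum>n\<in>UNIV. E h $ m $ n * E k $ m $ n))"
    unfolding sum_distrib_left by (rule sum.cong[OF refl], rule sum.swap)
  also have "\<dots> = 0"
    using q0 by (intro sum.neutral ballI) (auto simp: tr)
  finally show "(\<Sum>m\<in>UNIV. \<Sum>n\<in>UNIV. E h $ m $ n * schur_prod (E i) (E j) $ m $ n) = 0" .
qed (use sym idem ijh in auto)

lemma constant_idempotent_mult_vec:
  "(((1 / real (card \<Omega>)) *\<^sub>R adj_mat (\<Omega> \<times> \<Omega>)) *v u) $ x =
     (if x \<in> \<Omega> then (\<Sum>y\<in>\<Omega>. u $ y) / real (card \<Omega>) else 0)"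
proof -
  have "(((1 / real (card \<Omega>)) *\<^sub>R adj_mat (\<Omega> \<times> \<Omega>)) *v u) $ x =
      (\<Sum>y\<in>UNIV. if y \<in> \<Omega> then (if x \<in> \<Omega> then u $ y / real (card \<Omega>) else 0) else 0)"
    unfolding matrix_vector_mult_def by (auto simp: adj_mat_nth intro!: sum.cong)
  also have "\<dots> = (\<Sum>y\<in>\<Omega>. if x \<in> \<Omega> then u $ y / real (card \<Omega>) else 0)"
    by (simp add: sum.If_cases)
  finally show ?thesis
    by (simp add: sum_divide_distrib)
qed

section \<open>Sets supported on the trivial and odd eigenspaces\<close>

theorem theorem7p1:
  fixes P P' :: "'p::finite set"
    and L L' :: "'l set"
    and I :: "'p \<Rightarrow> 'l \<Rightarrow> bool"
    and s :: nat
    and \<Omega> \<theta> :: "'p set"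
    and E :: "nat \<Rightarrow> real ^ 'p ^ 'p"
    and V :: "nat \<Rightarrow> (real ^ 'p) set"
  assumes "s > 2"
    and "generalised_quadrangle P L I s (s\<^sup>2)"
    and "subquadrangle P' L' P L I s s"
    and "doubly_subtended P' P L I"
    and "\<Omega> = P - P'"
    and "Q_bipartite_ordering \<Omega> 4 (PW_rel P' P L I s) E"
    and "\<And>i. V i = col_space (E i)"
    and "\<theta> \<subseteq> \<Omega>" and "\<theta> \<noteq> {}" and "\<theta> \<noteq> \<Omega>"
    and "char_vec \<theta> \<in> orth_sum (V 0) (V 1) \<or>
         char_vec \<theta> \<in> orth_sum (V 0) (V 3) \<or>
         char_vec \<theta> \<in> orth_sum (orth_sum (V 0) (V 1)) (V 3)"
  shows "real (card \<theta>) = 1 / 2 * real (card \<Omega>)"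
proof -
  interpret D: doubly_subtended_gq P P' L L' I s
    by unfold_locales (use assms in auto)
  obtain q where bij: "bij_betw E {..4} {e. minimal_idempotent D.\<A> e}"
    and E0: "E 0 = (1 / real (card \<Omega>)) *\<^sub>R adj_mat (\<Omega> \<times> \<Omega>)"
    and krein: "krein_parameters \<Omega> 4 E q"
    and q0: "\<And>i j h. \<lbrakk>i \<le> 4; j \<le> 4; h \<le> 4; odd (i + j + h)\<rbrakk> \<Longrightarrow> q i j h = 0"
    using assms(6) unfolding Q_bipartite_ordering_def idempotent_ordering_def by blast
  have minimal: "minimal_idempotent D.\<A> (E i)" if "i \<le> 4" for i
    using bij_betwE[OF bij] that by auto
  then have E_in: "E i \<in> D.\<A>" and idem: "E i ** E i = E i" if "i \<le> 4" for i
    using that by (auto simp: minimal_idempotent_def)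
  have sym: "transpose (E i) = E i" if "i \<le> 4" for i
    using D.bm_symmetric E_in that by blast
  have orth: "E i ** E j = 0" if "i \<le> 4" "j \<le> 4" "i \<noteq> j" for i j
  proof (rule minimal_idempotents_orthogonal)
    show "E i \<noteq> E j"
      using bij_betw_imp_inj_on[OF bij] that by (auto dest: inj_onD)
  qed (use that minimal E_in D.bm_mult D.bm_commute in auto)
  have fixed: "E i *v u = u" if "i \<le> 4" "u \<in> V i" for i u
    using col_space_fixed[OF idem[OF that(1)]] that(2) assms(7) by simp
  have killed: "E i *v u = 0" if "i \<le> 4" "j \<le> 4" "i \<noteq> j" "u \<in> V j" for i j u
    by (metis fixed matrix_vector_mul_assoc matrix_vector_mult_0 orth that)
  have krein_killed: "E h *v (\<chi> m. u $ m * w $ m) = 0"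
    if "i \<le> 4" "j \<le> 4" "h \<le> 4" "odd (i + j + h)" "u \<in> V i" "w \<in> V j" for i j h u w
    using krein_zero_annihilates[OF sym idem orth krein, of i j h u w] q0 that assms(7) by simp

  have V0: "0 \<in> V i" for i
    using span_zero assms(7) by (simp add: col_space_def)
  \<comment> \<open>The three alternatives are merged by taking \<open>0\<close> for a missing
    component.\<close>
  obtain v0 v1 v3 where v: "v0 \<in> V 0" "v1 \<in> V 1" "v3 \<in> V 3"
    and chi: "char_vec \<theta> = v0 + v1 + v3"
  proof -
    consider u w where "u \<in> V 0" "w \<in> V 1" "char_vec \<theta> = u + w"
      | u w where "u \<in> V 0" "w \<in> V 3" "char_vec \<theta> = u + w"
      | u w z where "u \<in> V 0" "w \<in> V 1" "z \<in> V 3" "char_vec \<theta> = u + w + z"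
      using assms(11) unfolding orth_sum_def by blast
    then show ?thesis
    proof cases
      case (1 u w)
      then show ?thesis
        using that[of u w 0] V0 by simp
    next
      case (2 u w)
      then show ?thesis
        using that[of u 0 w] V0 by simp
    next
      case (3 u w z)
      then show ?thesis
        using that by blast
    qed
  qed
  define c where "c = real (card \<theta>) / real (card \<Omega>)"
  have "E 0 *v char_vec \<theta> = v0"
    using fixed[of 0 v0] killed[of 0 1 v1] killed[of 0 3 v3] v
    by (simp add: chi matrix_vector_right_distrib)
  moreover have "(\<Sum>y\<in>\<Omega>. char_vec \<theta> $ y) = real (card \<theta>)"
    using assms(8) by (simp add: char_vec_def sum.If_cases Int_absorb1)
  ultimately have v0: "v0 = c *\<^sub>R char_vec \<Omega>"
    using constant_idempotent_mult_vec[of \<Omega> "char_vec \<theta>"]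
    by (auto simp: vec_eq_iff E0[symmetric] c_def char_vec_def)
  \<comment> \<open>Since \<open>\<theta>\<close> is nonempty, \<open>c\<close> is nonzero, so
    \<open>char_vec \<Omega>\<close> is a multiple of \<open>v0\<close> and lies in
    \<open>V 0\<close>.\<close>
  have Omega_killed: "E h *v char_vec \<Omega> = 0" if "h \<le> 4" "h \<noteq> 0" for h
  proof -
    have "card \<theta> > 0" "card \<Omega> > 0"
      using assms(8,9) by (auto simp: card_gt_0_iff)
    then have "c \<noteq> 0"
      by (auto simp: c_def)
    moreover have "c *\<^sub>R (E h *v char_vec \<Omega>) = 0"
      using killed[of h 0 v0] that v(1) by (simp add: v0 matrix_vector_mult_scaleR)
    ultimately show ?thesis
      by simp
  qed

  let ?sq = "\<chi> m. (v1 + v3) $ m * (v1 + v3) $ m"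
  \<comment> \<open>Entrywise, \<open>char_vec \<theta>\<close> is idempotent and is unchanged by
    multiplication with \<open>char_vec \<Omega>\<close>, because
    \<open>\<theta> \<subseteq> \<Omega>\<close>.\<close>
  have "?sq = (1 - 2 * c) *\<^sub>R char_vec \<theta> + c\<^sup>2 *\<^sub>R char_vec \<Omega>"
  proof -
    have "v1 + v3 = char_vec \<theta> - c *\<^sub>R char_vec \<Omega>"
      using chi v0 by (simp add: algebra_simps)
    show ?thesis
      unfolding \<open>v1 + v3 = _\<close>
      using assms(8) by (auto simp: vec_eq_iff char_vec_def power2_eq_square algebra_simps)
  qed
  then have sq_eq: "E h *v ?sq = (1 - 2 * c) *\<^sub>R (E h *v char_vec \<theta>)" if "h \<le> 4" "h \<noteq> 0" for h
    using Omega_killed that by (simp add: matrix_vector_right_distrib matrix_vector_mult_scaleR)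
  \<comment> \<open>All four products in the expansion have indices in \<open>{1, 3}\<close>, so
    with \<open>h\<close> odd every index sum is odd and the Krein parameter vanishes.\<close>
  have sq_killed: "E h *v ?sq = 0" if "h \<le> 4" "odd h" for h
  proof -
    have "?sq = (\<chi> m. v1 $ m * v1 $ m) + (\<chi> m. v1 $ m * v3 $ m)
        + (\<chi> m. v3 $ m * v1 $ m) + (\<chi> m. v3 $ m * v3 $ m)"
      by (simp add: vec_eq_iff algebra_simps)
    then show ?thesis
      using krein_killed[of 1 1 h v1 v1] krein_killed[of 1 3 h v1 v3]
        krein_killed[of 3 1 h v3 v1] krein_killed[of 3 3 h v3 v3] that v
      by (simp add: matrix_vector_right_distrib)
  qed
  have "E 1 *v char_vec \<theta> = v1"
    using fixed[of 1 v1] killed[of 1 0 v0] killed[of 1 3 v3] v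
    by (simp add: chi matrix_vector_right_distrib)
  then have 1: "(1 - 2 * c) *\<^sub>R v1 = 0"
    using sq_eq[of 1] sq_killed[of 1] by simp
  have "E 3 *v char_vec \<theta> = v3"
    using fixed[of 3 v3] killed[of 3 0 v0] killed[of 3 1 v1] v
    by (simp add: chi matrix_vector_right_distrib)
  then have 3: "(1 - 2 * c) *\<^sub>R v3 = 0"
    using sq_eq[of 3] sq_killed[of 3] by simp
  have "c = 1 / 2"
  proof (rule ccontr)
    assume "c \<noteq> 1 / 2"
    then have "v1 = 0" "v3 = 0"
      using 1 3 by auto
    then have *: "char_vec \<theta> = c *\<^sub>R char_vec \<Omega>"
      using chi v0 by simp
    \<comment> \<open>Nontriviality of \<open>\<theta>\<close> enters here: evaluation at
      \<open>x\<close> gives \<open>c = 1\<close>, at \<open>y\<close> it gives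
      \<open>c = 0\<close>.\<close>
    obtain x y where "x \<in> \<theta>" "y \<in> \<Omega>" "y \<notin> \<theta>"
      using assms(8-10) by blast
    then have "1 = c" "0 = c"
      using arg_cong[OF *, of "\<lambda>u. u $ x"] arg_cong[OF *, of "\<lambda>u. u $ y"] assms(8)
      by (auto simp: char_vec_def)
    then show False
      by simp
  qed
  moreover have "card \<Omega> > 0"
    using assms(8,9) by (auto simp: card_gt_0_iff)
  ultimately show ?thesis
    by (simp add: c_def field_simps)
qed

end
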